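(* Let $A=A_n$ be a deterministic real symmetric $n\times n$ matrix ($n\ge2$), let $E=E_n$ be an $n\times n$ sub-Gaussian matrix, and let $\tilde A=A+E$. Put $\delta_1=\lambda_1-\lambda_2$. Fix a parameter $K=K(n)>0$, let $r$ be the number of eigenvalues of $A$ (with multiplicity) greater than $\lambda_1-\frac{\delta_1}{2}-3K\sqrt n$, and set $$L:=270\,\log(3+\sigma_1)\cdot\max\left\{\frac{\sqrt n}{K},\ \sqrt{r\log n}\cdot n^{1/4}\right\}.$$ Assume that $\delta_1\ge L$. Then, with probability $1-o(1)$ as $n\to\infty$, $$\tilde\lambda_1-\lambda_1\ \ge\ -L/2 .$$
   Context: $\lambda_1\ge\dots\ge\lambda_n$ are the eigenvalues of $A$, $\tilde\lambda_1\ge\dots\ge\tilde\lambda_n$ those of $\tilde A$, and $\sigma_1=\|A\|$ is the largest singular value (spectral norm) of $A$. Sub-Gaussian norm: $\|\xi\|_{\psi_2}:=\inf\{c>0:\mathbf E[\exp(\xi^2/c^2)]<2\}$. A symmetric random matrix $E=(\xi_{ij})_{i,j=1}^n$ is a sub-Gaussian matrix if the entries $(\xi_{ij})_{1\le i\le j\le n}$ are independent, centered, and satisfy $C_1\le\mathbf E\xi_{ij}^2\le1$ and $\max_{i,j}\|\xi_{ij}\|_{\psi_2}\le C_2$, for some constants $C_1,C_2>0$ not depending on $n$. Asymptotic notation is as $n\to\infty$ with $C_1,C_2$ fixed. *)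

theory Defs
  imports "HOL-Probability.Probability" "Jordan_Normal_Form.Char_Poly"
begin

(* Only real roots of the characteristic polynomial are listed, with multiplicity; for a
   real symmetric n x n matrix these are all n eigenvalues. *)
definition eigvals_mset :: "real mat \<Rightarrow> real multiset" where
  "eigvals_mset A = proots (char_poly A)"

definition eigvals_desc :: "real mat \<Rightarrow> real list" where
  "eigvals_desc A = rev (sorted_list_of_multiset (eigvals_mset A))"

(* The index is 1-based: eigval A 1 is the largest eigenvalue. *)
definition eigval :: "real mat \<Rightarrow> nat \<Rightarrow> real" where
  "eigval A k = eigvals_desc A ! (k - 1)"

definition largest_singular_value :: "real mat \<Rightarrow> real" where
  "largest_singular_value A = sqrt (eigval (transpose_mat A * A) 1)"

(* Extended-valued, so that the norm is infinite when no c qualifies; and with the nonnegative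
   integral, because the Bochner integral of a non-integrable function is 0. *)
definition psi2_norm :: "'a measure \<Rightarrow> ('a \<Rightarrow> real) \<Rightarrow> ennreal" where
  "psi2_norm M X =
     Inf {ennreal c | c. c > 0 \<and> (\<integral>\<^sup>+ \<omega>. ennreal (exp ((X \<omega>)\<^sup>2 / c\<^sup>2)) \<partial>M) < 2}"

(* The bound on psi2_norm makes the entries and their squares integrable, so the expectations
   below are genuine. *)
definition sub_gaussian_matrix ::
    "real \<Rightarrow> real \<Rightarrow> nat \<Rightarrow> 'a measure \<Rightarrow> ('a \<Rightarrow> real mat) \<Rightarrow> bool" where
  "sub_gaussian_matrix C1 C2 n M E \<longleftrightarrow>
     prob_space M \<and>
     (\<forall>\<omega>\<in>space M. E \<omega> \<in> carrier_mat n n \<and> transpose_mat (E \<omega>) = E \<omega>) \<and>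
     prob_space.indep_vars M (\<lambda>_. borel) (\<lambda>(i, j) \<omega>. E \<omega> $$ (i, j))
       {(i, j). i \<le> j \<and> j < n} \<and>
     (\<forall>i<n. \<forall>j<n.
        prob_space.expectation M (\<lambda>\<omega>. E \<omega> $$ (i, j)) = 0 \<and>
        C1 \<le> prob_space.expectation M (\<lambda>\<omega>. (E \<omega> $$ (i, j))\<^sup>2) \<and>
        prob_space.expectation M (\<lambda>\<omega>. (E \<omega> $$ (i, j))\<^sup>2) \<le> 1 \<and>
        psi2_norm M (\<lambda>\<omega>. E \<omega> $$ (i, j)) \<le> ennreal C2)"

definition top_gap :: "real mat \<Rightarrow> real" where
  "top_gap A = eigval A 1 - eigval A 2"

definition num_top_eigvals :: "nat \<Rightarrow> real mat \<Rightarrow> real \<Rightarrow> nat" where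
  "num_top_eigvals n A K =
     size {# x \<in># eigvals_mset A. x > eigval A 1 - top_gap A / 2 - 3 * K * sqrt (real n) #}"

definition gap_threshold :: "nat \<Rightarrow> real mat \<Rightarrow> real \<Rightarrow> real" where
  "gap_threshold n A K =
     270 * ln (3 + largest_singular_value A) *
     max (sqrt (real n) / K)
         (sqrt (real (num_top_eigvals n A K) * ln (real n)) * real n powr (1 / 4))"

end

theory Submission
  imports Defs "HOL-Real_Asymp.Real_Asymp"
begin

text \<open>Let \<open>v\<close> be a unit eigenvector of \<open>A\<close> for its largest eigenvalue. The variational principle for
  \<open>A + E\<close>, tested on \<open>v\<close>, bounds its largest eigenvalue below by that of \<open>A\<close> plus \<open>v\<^sup>T E v\<close>. This
  quadratic form is centered with second moment at most \<open>4\<close>, so by Chebyshev's inequality it is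
  below \<open>-L/2\<close> with probability at most \<open>16/L\<^sup>2\<close>. The gap condition makes \<open>\<delta>\<^sub>1\<close> positive, hence
  \<open>r \<ge> 1\<close> and \<open>L \<ge> 270 (log n)\<^sup>1\<^sup>/\<^sup>2 n\<^sup>1\<^sup>/\<^sup>4\<close>, which tends to infinity.\<close>

section \<open>Maximising a quadratic form over the unit sphere\<close>

text \<open>Vectors are functions on \<open>nat\<close> of which only the first \<open>n\<close>
  coordinates count. Compactness and limits then come from the product topology.\<close>

definition quadratic_form :: "nat \<Rightarrow> real mat \<Rightarrow> (nat \<Rightarrow> real) \<Rightarrow> real" where
  "quadratic_form n B x = (\<Sum>i<n. \<Sum>j<n. B $$ (i, j) * x i * x j)"

text \<open>A closed subset of a product of intervals \<open>{-1..1}\<close> and singletons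
  \<open>{0}\<close>, which is compact by Tychonoff. Coordinates from \<open>n\<close> on are pinned
  to 0, since free ones would destroy compactness.\<close>

lemma compact_unit_sphere:
  "compact {x :: nat \<Rightarrow> real. (\<forall>i\<ge>n. x i = 0) \<and> (\<Sum>i<n. (x i)\<^sup>2) = 1}" (is "compact ?S")
proof -
  let ?C = "\<lambda>i. if i < n then {-1..1} else {0::real}"
  have "compactin (product_topology (\<lambda>i. euclidean) UNIV) (PiE UNIV ?C)"
    by (subst compactin_PiE) auto
  then have "compact (PiE UNIV ?C)"
    by (simp add: euclidean_product_topology)
  moreover have "closed {x :: nat \<Rightarrow> real. (\<Sum>i<n. (x i)\<^sup>2) = 1}"
    by (intro closed_Collect_eq continuous_intros continuous_on_product_coordinates)
  ultimately have "compact (PiE UNIV ?C \<inter> {x. (\<Sum>i<n. (x i)\<^sup>2) = 1})"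
    by (rule compact_Int_closed)
  also have "PiE UNIV ?C \<inter> {x. (\<Sum>i<n. (x i)\<^sup>2) = 1} = ?S"
  proof (intro equalityI subsetI)
    fix x assume x: "x \<in> ?S"
    have "x i \<in> {-1..1}" if "i < n" for i
    proof -
      have "(x i)\<^sup>2 \<le> (\<Sum>i<n. (x i)\<^sup>2)"
        using that by (intro member_le_sum) auto
      then have "(x i)\<^sup>2 \<le> 1" using x by simp
      then have "\<bar>x i\<bar> \<le> 1" by (simp add: abs_square_le_1)
      then show ?thesis by auto
    qed
    with x show "x \<in> PiE UNIV ?C \<inter> {x. (\<Sum>i<n. (x i)\<^sup>2) = 1}" by (auto simp: PiE_iff)
  next
    fix x assume "x \<in> PiE UNIV ?C \<inter> {x. (\<Sum>i<n. (x i)\<^sup>2) = 1}"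
    then have C: "x i \<in> ?C i" and "(\<Sum>i<n. (x i)\<^sup>2) = 1" for i by (auto simp: PiE_iff)
    moreover have "x i = 0" if "i \<ge> n" for i using C[of i] that by simp
    ultimately show "x \<in> ?S" by simp
  qed
  finally show ?thesis .
qed

lemma quadratic_form_scale:
  "quadratic_form n B (\<lambda>i. c * x i) = c\<^sup>2 * quadratic_form n B x"
  by (simp add: quadratic_form_def sum_distrib_left power2_eq_square algebra_simps)

lemma quadratic_form_cong:
  "(\<And>i. i < n \<Longrightarrow> x i = y i) \<Longrightarrow> quadratic_form n B x = quadratic_form n B y"
  by (simp add: quadratic_form_def)

text \<open>A continuous function attains its maximum on the compact sphere, and homogeneity of
  degree 2 carries the bound to every \<open>x\<close>. The form without division also covers
  \<open>x = 0\<close> and functions that do not vanish beyond \<open>n\<close>.\<close>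

lemma quadratic_form_max_exists:
  assumes "n \<ge> 1"
  obtains v where "(\<Sum>i<n. (v i)\<^sup>2) = 1"
    and "\<And>x. quadratic_form n B x \<le> quadratic_form n B v * (\<Sum>i<n. (x i)\<^sup>2)"
proof -
  define S :: "(nat \<Rightarrow> real) set"
    where "S = {x. (\<forall>i\<ge>n. x i = 0) \<and> (\<Sum>i<n. (x i)\<^sup>2) = 1}"
  define e :: "nat \<Rightarrow> real" where "e i = (if i = 0 then 1 else 0)" for i
  have "(\<Sum>i<n. (e i)\<^sup>2) = (\<Sum>i<n. if i = 0 then 1 else 0)"
    by (intro sum.cong) (auto simp: e_def)
  also have "\<dots> = 1" using assms by simp
  finally have "e \<in> S" using assms by (simp add: S_def e_def)
  then have ne: "S \<noteq> {}" by blast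
  have compact: "compact S" unfolding S_def by (rule compact_unit_sphere)
  have "continuous_on S (\<lambda>x. x i)" for i
    by (rule continuous_on_subset[OF continuous_on_product_coordinates subset_UNIV])
  then have cont: "continuous_on S (quadratic_form n B)"
    unfolding quadratic_form_def
    by (intro continuous_on_sum continuous_on_mult continuous_on_const)
  obtain v where "v \<in> S"
    and max: "\<And>x. x \<in> S \<Longrightarrow> quadratic_form n B x \<le> quadratic_form n B v"
    using continuous_attains_sup[OF compact ne cont] by blast
  then have v: "(\<Sum>i<n. (v i)\<^sup>2) = 1" by (simp add: S_def)
  have "quadratic_form n B x \<le> quadratic_form n B v * (\<Sum>i<n. (x i)\<^sup>2)" for x
  proof (cases "(\<Sum>i<n. (x i)\<^sup>2) = 0")
    case True
    then have "x i = 0" if "i < n" for i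
      using that by (simp add: sum_nonneg_eq_0_iff)
    then show ?thesis using True by (simp add: quadratic_form_def)
  next
    case False
    let ?s = "\<Sum>i<n. (x i)\<^sup>2"
    have s: "?s > 0" using False sum_nonneg[of "{..<n}" "\<lambda>i. (x i)\<^sup>2"] by simp
    \<comment> \<open>Normalising is not enough for membership in \<open>S\<close>: the tail must be
      cut off as well, which the form does not notice.\<close>
    define y where "y i = (if i < n then 1 / sqrt ?s * x i else 0)" for i
    have "(\<Sum>i<n. (y i)\<^sup>2) = (\<Sum>i<n. (x i)\<^sup>2 / ?s)"
      using s by (intro sum.cong) (auto simp: y_def power_divide power_mult_distrib)
    also have "\<dots> = 1" using s by (simp flip: sum_divide_distrib)
    finally have "y \<in> S" by (simp add: S_def y_def)
    then have "quadratic_form n B y \<le> quadratic_form n B v" by (rule max)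
    moreover have "quadratic_form n B y = quadratic_form n B (\<lambda>i. 1 / sqrt ?s * x i)"
      by (intro quadratic_form_cong) (simp add: y_def)
    ultimately have "(1 / sqrt ?s)\<^sup>2 * quadratic_form n B x \<le> quadratic_form n B v"
      by (simp only: quadratic_form_scale)
    then show ?thesis using s by (simp add: power_divide field_simps)
  qed
  with v show thesis by (rule that)
qed

section \<open>A maximiser is an eigenvector\<close>

text \<open>First-order condition without derivatives: near 0 the linear term dominates, so a
  nonzero one would make the polynomial positive for a small \<open>t\<close> of the right
  sign.\<close>

lemma linear_coefficient_zero:
  fixes a b :: real
  assumes "\<And>t. 2 * t * a + t\<^sup>2 * b \<le> 0"
  shows "a = 0"
proof (rule ccontr)
  assume "a \<noteq> 0"
  \<comment> \<open>This \<open>t\<close> has the sign of \<open>a\<close>, and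
    \<open>2 * t * a\<close> equals \<open>2 * t^2 * (\<bar>b\<bar> + 1)\<close>, which outweighs
    \<open>t^2 * b\<close>.\<close>
  define t where "t = a / (\<bar>b\<bar> + 1)"
  have "t * (\<bar>b\<bar> + 1) = a" by (simp add: t_def)
  then have "2 * t * a + t\<^sup>2 * b = t\<^sup>2 * (2 * (\<bar>b\<bar> + 1) + b)"
    by (simp add: power2_eq_square algebra_simps flip: \<open>t * (\<bar>b\<bar> + 1) = a\<close>)
  moreover have "t \<noteq> 0" using \<open>a \<noteq> 0\<close> by (simp add: t_def)
  moreover have "2 * (\<bar>b\<bar> + 1) + b > 0" using abs_ge_zero[of b] abs_ge_minus_self[of b] by argo
  ultimately show False using assms[of t] by (simp add: mult_le_0_iff)
qed

lemma symmetric_mat_index: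
  assumes "B \<in> carrier_mat n n" "transpose_mat B = B" "i < n" "j < n"
  shows "B $$ (i, j) = B $$ (j, i)"
  using assms by (metis carrier_matD index_transpose_mat(1))

text \<open>Expansion along the \<open>k\<close>-th unit vector. Symmetry makes the two mixed sums
  equal, hence the factor 2.\<close>

lemma quadratic_form_add_unit:
  assumes "B \<in> carrier_mat n n" "transpose_mat B = B" "k < n"
  shows "quadratic_form n B (\<lambda>i. v i + (if i = k then t else 0)) =
    quadratic_form n B v + 2 * t * (\<Sum>j<n. B $$ (k, j) * v j) + t\<^sup>2 * B $$ (k, k)"
proof -
  let ?e = "\<lambda>i. if i = k then t else 0"
  have "quadratic_form n B (\<lambda>i. v i + ?e i) =
    (\<Sum>i<n. \<Sum>j<n. B $$ (i, j) * v i * v j) + (\<Sum>i<n. \<Sum>j<n. B $$ (i, j) * v i * ?e j)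
    + (\<Sum>i<n. \<Sum>j<n. B $$ (i, j) * ?e i * v j) + (\<Sum>i<n. \<Sum>j<n. B $$ (i, j) * ?e i * ?e j)"
    unfolding quadratic_form_def sum.distrib[symmetric]
    by (intro sum.cong refl) (simp add: algebra_simps)
  also have "(\<Sum>i<n. \<Sum>j<n. B $$ (i, j) * v i * ?e j) = t * (\<Sum>j<n. B $$ (k, j) * v j)"
  proof -
    have "(\<Sum>i<n. \<Sum>j<n. B $$ (i, j) * v i * ?e j) = (\<Sum>i<n. B $$ (i, k) * v i * t)"
      using assms(3) by (simp add: if_distrib cong: if_cong)
    also have "\<dots> = (\<Sum>i<n. B $$ (k, i) * v i * t)"
      using symmetric_mat_index[OF assms(1,2)] assms(3) by (intro sum.cong) auto
    finally show ?thesis by (simp add: sum_distrib_left mult_ac)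
  qed
  also have "(\<Sum>i<n. \<Sum>j<n. B $$ (i, j) * ?e i * v j) = t * (\<Sum>j<n. B $$ (k, j) * v j)"
  proof -
    have "(\<Sum>i<n. \<Sum>j<n. B $$ (i, j) * ?e i * v j) = (\<Sum>i<n. ?e i * (\<Sum>j<n. B $$ (i, j) * v j))"
      by (simp add: sum_distrib_left mult_ac)
    then show ?thesis using assms(3)
      by (simp add: if_distrib[of "\<lambda>x. x * c" for c] cong: if_cong)
  qed
  also have "(\<Sum>i<n. \<Sum>j<n. B $$ (i, j) * ?e i * ?e j) = t\<^sup>2 * B $$ (k, k)"
  proof -
    have "(\<Sum>i<n. \<Sum>j<n. B $$ (i, j) * ?e i * ?e j) = (\<Sum>i<n. ?e i * (\<Sum>j<n. B $$ (i, j) * ?e j))"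
      by (simp add: sum_distrib_left mult_ac)
    also have "\<dots> = t * (\<Sum>j<n. B $$ (k, j) * ?e j)"
      using assms(3) by (simp add: if_distrib[of "\<lambda>x. x * c" for c] cong: if_cong)
    also have "\<dots> = t * (B $$ (k, k) * t)"
      using assms(3) by (simp add: if_distrib cong: if_cong)
    finally show ?thesis by (simp add: power2_eq_square mult_ac)
  qed
  finally show ?thesis by (simp add: quadratic_form_def)
qed

lemma sum_squares_add_unit:
  fixes k n :: nat
  assumes "k < n"
  shows "(\<Sum>i<n. (v i + (if i = k then t else 0))\<^sup>2) = (\<Sum>i<n. (v i)\<^sup>2) + 2 * t * v k + (t :: real)\<^sup>2"
proof -
  have "(\<Sum>i<n. (v i + (if i = k then t else 0))\<^sup>2) =
    (\<Sum>i<n. (v i)\<^sup>2 + (if i = k then 2 * t * v k + t\<^sup>2 else 0))"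
    by (intro sum.cong) (auto simp: power2_eq_square algebra_simps)
  then show ?thesis using assms by (simp add: sum.distrib)
qed

text \<open>Testing maximality on \<open>v\<close> plus \<open>t\<close> times the
  \<open>k\<close>-th unit vector leaves a nonpositive polynomial in \<open>t\<close> without
  constant term. Its linear coefficient is twice the difference of the two sides.\<close>

lemma quadratic_form_max_eigenvector:
  assumes B: "B \<in> carrier_mat n n" "transpose_mat B = B"
    and v: "(\<Sum>i<n. (v i)\<^sup>2) = 1"
    and max: "\<And>x. quadratic_form n B x \<le> quadratic_form n B v * (\<Sum>i<n. (x i)\<^sup>2)"
    and k: "k < n"
  shows "(\<Sum>j<n. B $$ (k, j) * v j) = quadratic_form n B v * v k"
proof -
  let ?m = "quadratic_form n B v"
  have "2 * t * ((\<Sum>j<n. B $$ (k, j) * v j) - ?m * v k) + t\<^sup>2 * (B $$ (k, k) - ?m) \<le> 0" for t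
    using max[of "\<lambda>i. v i + (if i = k then t else 0)"]
    unfolding quadratic_form_add_unit[OF B k] sum_squares_add_unit[OF k] v
    by (simp add: algebra_simps)
  from linear_coefficient_zero[OF this] show ?thesis by simp
qed

section \<open>The largest eigenvalue as the maximum of the quadratic form\<close>

lemma mem_eigvals_mset:
  assumes "B \<in> carrier_mat n n"
  shows "x \<in># eigvals_mset B \<longleftrightarrow> eigenvalue B x"
proof -
  \<comment> \<open>Being monic, the polynomial is nonzero; only then does \<open>proots\<close>
    contain exactly the roots.\<close>
  have "char_poly B \<noteq> 0" using degree_monic_char_poly[OF assms] by auto
  then show ?thesis
    using eigenvalue_root_char_poly[OF assms] by (simp add: eigvals_mset_def)
qed

text \<open>Index 0 of the reversed ascending list is its last entry. This needs a nonempty list,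
  which membership of \<open>m\<close> supplies.\<close>

lemma eigval_1_eqI:
  assumes "m \<in># eigvals_mset B" "\<And>x. x \<in># eigvals_mset B \<Longrightarrow> x \<le> m"
  shows "eigval B 1 = m"
proof -
  let ?l = "sorted_list_of_multiset (eigvals_mset B)"
  have set: "set ?l = set_mset (eigvals_mset B)" by simp
  then have ne: "?l \<noteq> []" using assms(1) by fastforce
  then have eq: "eigval B 1 = last ?l"
    by (simp add: eigval_def eigvals_desc_def hd_rev flip: hd_conv_nth)
  obtain k where "k < length ?l" "?l ! k = m"
    using assms(1) set by (metis in_set_conv_nth)
  then have "m \<le> last ?l"
    using ne sorted_nth_mono[of ?l k "length ?l - 1"]
    by (simp add: last_conv_nth sorted_sorted_list_of_multiset)
  moreover have "last ?l \<le> m" using assms(2) ne set last_in_set by blast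
  ultimately show ?thesis using eq by simp
qed

lemma quadratic_form_eigenvector:
  fixes w :: "real Matrix.vec"
  assumes B: "B \<in> carrier_mat n n" and "eigenvector B w m"
  shows "quadratic_form n B (\<lambda>i. w $ i) = m * (\<Sum>i<n. (w $ i)\<^sup>2)" "(\<Sum>i<n. (w $ i)\<^sup>2) > 0"
proof -
  have w: "w \<in> carrier_vec n" "w \<noteq> 0\<^sub>v n" "B *\<^sub>v w = m \<cdot>\<^sub>v w"
    using assms by (auto simp: eigenvector_def)
  have row: "(\<Sum>j<n. B $$ (i, j) * w $ j) = m * w $ i" if "i < n" for i
  proof -
    have "(B *\<^sub>v w) $ i = (\<Sum>j<n. B $$ (i, j) * w $ j)"
      using that B w(1) by (auto simp: scalar_prod_def atLeast0LessThan intro!: sum.cong)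
    then show ?thesis using that w by simp
  qed
  have "quadratic_form n B (\<lambda>i. w $ i) = (\<Sum>i<n. w $ i * (\<Sum>j<n. B $$ (i, j) * w $ j))"
    by (simp add: quadratic_form_def sum_distrib_left mult_ac)
  also have "\<dots> = (\<Sum>i<n. w $ i * (m * w $ i))" by (intro sum.cong) (auto simp: row)
  finally show "quadratic_form n B (\<lambda>i. w $ i) = m * (\<Sum>i<n. (w $ i)\<^sup>2)"
    by (simp add: sum_distrib_left power2_eq_square mult_ac)
  have "\<exists>i<n. w $ i \<noteq> 0"
  proof (rule ccontr)
    assume "\<not> ?thesis"
    then have "w = 0\<^sub>v n" using w(1) by (intro eq_vecI) auto
    with w(2) show False ..
  qed
  then obtain i where "i < n" "w $ i \<noteq> 0" by blast
  then show "(\<Sum>i<n. (w $ i)\<^sup>2) > 0" by (intro sum_pos2[of _ i]) auto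
qed

text \<open>The maximum is an eigenvalue because the maximiser is an eigenvector. No eigenvalue
  exceeds it, since each is the Rayleigh quotient of its own eigenvector.\<close>

lemma rayleigh_eigval_1:
  assumes B: "B \<in> carrier_mat n n" "transpose_mat B = B" and "n \<ge> 1"
  obtains v where "(\<Sum>i<n. (v i)\<^sup>2) = 1" "quadratic_form n B v = eigval B 1"
    "eigval B 1 \<in># eigvals_mset B"
    "\<And>x. quadratic_form n B x \<le> eigval B 1 * (\<Sum>i<n. (x i)\<^sup>2)"
proof -
  obtain v where v: "(\<Sum>i<n. (v i)\<^sup>2) = 1"
    and max: "\<And>x. quadratic_form n B x \<le> quadratic_form n B v * (\<Sum>i<n. (x i)\<^sup>2)"
    using quadratic_form_max_exists[OF \<open>n \<ge> 1\<close>] by metis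
  let ?m = "quadratic_form n B v"
  have "vec n v \<noteq> 0\<^sub>v n"
  proof
    assume z: "vec n v = 0\<^sub>v n"
    have "v i = 0" if "i < n" for i
      using that arg_cong[OF z, of "\<lambda>u. vec_index u i"] by simp
    with v show False by simp
  qed
  moreover have "B *\<^sub>v vec n v = ?m \<cdot>\<^sub>v vec n v"
  proof (intro eq_vecI)
    fix i assume "i < dim_vec (?m \<cdot>\<^sub>v vec n v)"
    then have i: "i < n" by simp
    then have "(B *\<^sub>v vec n v) $ i = (\<Sum>j<n. B $$ (i, j) * v j)"
      using B by (auto simp: scalar_prod_def atLeast0LessThan intro!: sum.cong)
    then show "(B *\<^sub>v vec n v) $ i = (?m \<cdot>\<^sub>v vec n v) $ i"
      using quadratic_form_max_eigenvector[OF B v max i] i by simp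
  qed (use B in auto)
  ultimately have "eigenvalue B ?m"
    using B unfolding eigenvalue_def eigenvector_def by (intro exI[of _ "vec n v"]) auto
  moreover have "x \<le> ?m" if x: "eigenvalue B x" for x
  proof -
    obtain w :: "real Matrix.vec" where "eigenvector B w x" using x by (auto simp: eigenvalue_def)
    note w = quadratic_form_eigenvector[OF B(1) this]
    from max[of "\<lambda>i. w $ i"] w show ?thesis by simp
  qed
  ultimately have mem: "?m \<in># eigvals_mset B" and eq: "eigval B 1 = ?m"
    using mem_eigvals_mset[OF B(1)] by (simp, intro eigval_1_eqI) auto
  show thesis
    by (rule that[of v]) (use v max mem eq in auto)
qed

text \<open>The real \<open>sqrt\<close> is odd, so it would be negative at a negative argument. The
  radicand is nonnegative because it is a value of the form of \<open>transpose_mat A * A\<close>,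
  that is, a squared length of \<open>A\<close> applied to a vector.\<close>

lemma largest_singular_value_nonneg:
  assumes A: "A \<in> carrier_mat n n" and "n \<ge> 1"
  shows "largest_singular_value A \<ge> 0"
proof -
  let ?B = "transpose_mat A * A"
  have "?B \<in> carrier_mat n n" using A by auto
  moreover have "transpose_mat ?B = ?B"
    using A by (simp add: transpose_mult[of "transpose_mat A" n n A n])
  ultimately obtain v where "quadratic_form n ?B v = eigval ?B 1"
    using rayleigh_eigval_1[OF _ _ \<open>n \<ge> 1\<close>] by metis
  moreover have "quadratic_form n ?B v = (\<Sum>k<n. (\<Sum>i<n. A $$ (k, i) * v i)\<^sup>2)"
  proof -
    have "quadratic_form n ?B v =
      (\<Sum>i<n. \<Sum>j<n. \<Sum>k<n. A $$ (k, i) * v i * (A $$ (k, j) * v j))"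
      unfolding quadratic_form_def using A
      by (intro sum.cong refl)
        (auto simp: scalar_prod_def atLeast0LessThan sum_distrib_right sum_distrib_left mult_ac
          intro!: sum.cong)
    also have "\<dots> = (\<Sum>i<n. \<Sum>k<n. \<Sum>j<n. A $$ (k, i) * v i * (A $$ (k, j) * v j))"
      by (intro sum.cong refl sum.swap)
    also have "\<dots> = (\<Sum>k<n. \<Sum>i<n. \<Sum>j<n. A $$ (k, i) * v i * (A $$ (k, j) * v j))"
      by (rule sum.swap)
    finally show ?thesis by (simp add: power2_eq_square sum_product)
  qed
  ultimately have "eigval ?B 1 = (\<Sum>k<n. (\<Sum>i<n. A $$ (k, i) * v i)\<^sup>2)" by linarith
  then have "eigval ?B 1 \<ge> 0" by (simp only: sum_nonneg zero_le_power2)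
  then show ?thesis by (simp add: largest_singular_value_def)
qed

section \<open>Measurability of the largest eigenvalue\<close>

text \<open>By continuity rational vectors suffice, so \<^term>\<open>eigval B 1 \<le> c\<close> is a countable
  conjunction of conditions that are linear in the entries of \<^term>\<open>B\<close>.\<close>
lemma eigval_1_le_iff:
  assumes B: "B \<in> carrier_mat n n" "transpose_mat B = B" and "n \<ge> 1"
  shows "eigval B 1 \<le> c \<longleftrightarrow>
    (\<forall>x \<in> PiE {..<n} (\<lambda>_. \<rat>). quadratic_form n B x \<le> c * (\<Sum>i<n. (x i)\<^sup>2))"
proof
  obtain v where v: "(\<Sum>i<n. (v i)\<^sup>2) = 1" "quadratic_form n B v = eigval B 1"
    and max: "\<And>x. quadratic_form n B x \<le> eigval B 1 * (\<Sum>i<n. (x i)\<^sup>2)"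
    using rayleigh_eigval_1[OF assms] by metis
  {
    assume "eigval B 1 \<le> c"
    then show "\<forall>x \<in> PiE {..<n} (\<lambda>_. \<rat>). quadratic_form n B x \<le> c * (\<Sum>i<n. (x i)\<^sup>2)"
      using max by (meson mult_right_mono order_trans sum_nonneg zero_le_power2)
  next
    assume le: "\<forall>x \<in> PiE {..<n} (\<lambda>_. \<rat>). quadratic_form n B x \<le> c * (\<Sum>i<n. (x i)\<^sup>2)"
    \<comment> \<open>The approximants of \<open>v\<close> need not have length 1, which is why the
      condition carries the factor of summed squares.\<close>
    have "\<exists>q. (\<forall>k. q k \<in> \<rat>) \<and> q \<longlonglongrightarrow> v i" for i
      using closure_sequential[of "v i" \<rat>] by (simp add: Rats_closure_real)
    then obtain q where q: "\<And>i k. q i k \<in> \<rat>" "\<And>i. q i \<longlonglongrightarrow> v i" by metis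
    have "quadratic_form n B (\<lambda>i. q i k) \<le> c * (\<Sum>i<n. (q i k)\<^sup>2)" for k
    proof -
      \<comment> \<open>Membership in \<open>PiE\<close> requires the default value outside
        \<open>{..<n}\<close>; that extensionality keeps the index set countable.\<close>
      let ?x = "restrict (\<lambda>i. q i k) {..<n}"
      have "?x \<in> PiE {..<n} (\<lambda>_. \<rat>)" using q by auto
      then have "quadratic_form n B ?x \<le> c * (\<Sum>i<n. (?x i)\<^sup>2)" using le by blast
      moreover have "quadratic_form n B ?x = quadratic_form n B (\<lambda>i. q i k)"
        by (intro quadratic_form_cong) simp
      ultimately show ?thesis by simp
    qed
    moreover have "(\<lambda>k. quadratic_form n B (\<lambda>i. q i k)) \<longlonglongrightarrow> quadratic_form n B v"
      unfolding quadratic_form_def by (intro tendsto_intros q)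
    moreover have "(\<lambda>k. c * (\<Sum>i<n. (q i k)\<^sup>2)) \<longlonglongrightarrow> c * (\<Sum>i<n. (v i)\<^sup>2)"
      by (intro tendsto_intros q)
    ultimately have "quadratic_form n B v \<le> c * (\<Sum>i<n. (v i)\<^sup>2)"
      by (intro LIMSEQ_le) auto
    then show "eigval B 1 \<le> c" using v by simp
  }
qed

text \<open>Makes the final event measurable; \<open>measure\<close> is 0 on a nonmeasurable set, so
  a lower bound depends on this.\<close>

lemma measurable_eigval_1:
  assumes carrier: "\<And>\<omega>. \<omega> \<in> space M \<Longrightarrow> B \<omega> \<in> carrier_mat n n"
    and sym: "\<And>\<omega>. \<omega> \<in> space M \<Longrightarrow> transpose_mat (B \<omega>) = B \<omega>" and "n \<ge> 1"
    and entries: "\<And>i j. i < n \<Longrightarrow> j < n \<Longrightarrow> (\<lambda>\<omega>. B \<omega> $$ (i, j)) \<in> borel_measurable M"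
  shows "(\<lambda>\<omega>. eigval (B \<omega>) 1) \<in> borel_measurable M"
  unfolding borel_measurable_iff_le
proof
  fix c
  let ?Q = "PiE {..<n} (\<lambda>_. \<rat> :: real set)"
  have "{\<omega> \<in> space M. eigval (B \<omega>) 1 \<le> c} =
    {\<omega> \<in> space M. \<forall>x\<in>?Q. quadratic_form n (B \<omega>) x \<le> c * (\<Sum>i<n. (x i)\<^sup>2)}"
    using eigval_1_le_iff[OF carrier sym \<open>n \<ge> 1\<close>] by auto
  moreover have "(\<lambda>\<omega>. quadratic_form n (B \<omega>) x) \<in> borel_measurable M" for x
    unfolding quadratic_form_def
    by (intro borel_measurable_sum borel_measurable_times borel_measurable_const entries) auto
  moreover have "countable ?Q"
    by (intro countable_PiE) (auto simp: countable_rat)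
  ultimately show "{\<omega> \<in> space M. eigval (B \<omega>) 1 \<le> c} \<in> sets M"
    by (auto intro!: sets.sets_Collect_countable_Ball)
qed

section \<open>Second moments of the entries and of their weighted sums\<close>

text \<open>A finite infimum yields an admissible \<open>c\<close>, and \<open>y \<le> exp y\<close>
  at \<open>y = (X \<omega>)^2 / c^2\<close> dominates the square by an integrable function.\<close>

lemma psi2_norm_square_integrable:
  assumes X: "X \<in> borel_measurable M" and fin: "psi2_norm M X < \<infinity>"
  shows "integrable M (\<lambda>\<omega>. (X \<omega>)\<^sup>2)"
proof -
  obtain c where c: "c > 0" "(\<integral>\<^sup>+ \<omega>. ennreal (exp ((X \<omega>)\<^sup>2 / c\<^sup>2)) \<partial>M) < 2"
    using fin unfolding psi2_norm_def Inf_less_iff by blast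
  have "(\<integral>\<^sup>+ \<omega>. ennreal (exp ((X \<omega>)\<^sup>2 / c\<^sup>2)) \<partial>M) < \<infinity>"
    using c(2) by (rule less_trans) simp
  then have int: "integrable M (\<lambda>\<omega>. exp ((X \<omega>)\<^sup>2 / c\<^sup>2))"
    using X by (intro integrableI_bounded) auto
  have le: "AE \<omega> in M. norm ((X \<omega>)\<^sup>2 / c\<^sup>2) \<le> norm (exp ((X \<omega>)\<^sup>2 / c\<^sup>2))"
  proof (intro AE_I2)
    fix \<omega>
    have "(X \<omega>)\<^sup>2 / c\<^sup>2 \<le> exp ((X \<omega>)\<^sup>2 / c\<^sup>2)"
      using exp_ge_add_one_self[of "(X \<omega>)\<^sup>2 / c\<^sup>2"] by linarith
    then show "norm ((X \<omega>)\<^sup>2 / c\<^sup>2) \<le> norm (exp ((X \<omega>)\<^sup>2 / c\<^sup>2))" by simp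
  qed
  have "integrable M (\<lambda>\<omega>. (X \<omega>)\<^sup>2 / c\<^sup>2)"
    using X by (intro Bochner_Integration.integrable_bound[OF int _ le]) simp
  then have "integrable M (\<lambda>\<omega>. c\<^sup>2 * ((X \<omega>)\<^sup>2 / c\<^sup>2))"
    by (rule integrable_mult_right)
  then show ?thesis using c(1) by simp
qed

context prob_space
begin

text \<open>Expanding the square gives a double sum. Independence and zero means remove the
  off-diagonal expectations, and the diagonal ones are at most the squared weights.\<close>

lemma
  fixes X :: "'i \<Rightarrow> 'a \<Rightarrow> real"
  assumes "finite I" and indep: "indep_vars (\<lambda>_. borel) X I"
    and sq: "\<And>i. i \<in> I \<Longrightarrow> integrable M (\<lambda>\<omega>. (X i \<omega>)\<^sup>2)"
    and mean: "\<And>i. i \<in> I \<Longrightarrow> expectation (X i) = 0"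
    and var: "\<And>i. i \<in> I \<Longrightarrow> expectation (\<lambda>\<omega>. (X i \<omega>)\<^sup>2) \<le> 1"
  shows integrable_square_weighted_sum: "integrable M (\<lambda>\<omega>. (\<Sum>i\<in>I. c i * X i \<omega>)\<^sup>2)"
    and second_moment_weighted_sum: "expectation (\<lambda>\<omega>. (\<Sum>i\<in>I. c i * X i \<omega>)\<^sup>2) \<le> (\<Sum>i\<in>I. (c i)\<^sup>2)"
proof -
  have X: "random_variable borel (X i)" if "i \<in> I" for i
    using indep that unfolding indep_vars_def by blast
  have int: "integrable M (X i)" if "i \<in> I" for i
    by (rule square_integrable_imp_integrable[OF X[OF that] sq[OF that]])
  have prod: "integrable M (\<lambda>\<omega>. X i \<omega> * X j \<omega>) \<and> expectation (\<lambda>\<omega>. X i \<omega> * X j \<omega>) = 0"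
    if "i \<in> I" "j \<in> I" "i \<noteq> j" for i j
  proof -
    have "indep_vars (\<lambda>_. borel) X {i, j}"
      using indep that by (elim indep_vars_subset) auto
    from indep_vars_integrable[OF _ this] indep_vars_lebesgue_integral[OF _ this] that int mean
    show ?thesis by auto
  qed
  \<comment> \<open>Off the diagonal integrability comes from independence, on it from
    \<open>sq\<close>.\<close>
  have int2: "integrable M (\<lambda>\<omega>. c i * c j * (X i \<omega> * X j \<omega>))" if "i \<in> I" "j \<in> I" for i j
    using prod[OF that] sq that by (cases "i = j") (auto simp flip: power2_eq_square)
  have expand: "(\<Sum>i\<in>I. c i * X i \<omega>)\<^sup>2 = (\<Sum>i\<in>I. \<Sum>j\<in>I. c i * c j * (X i \<omega> * X j \<omega>))" for \<omega>
    by (simp add: power2_eq_square sum_product mult_ac)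
  show "integrable M (\<lambda>\<omega>. (\<Sum>i\<in>I. c i * X i \<omega>)\<^sup>2)"
    unfolding expand by (intro Bochner_Integration.integrable_sum int2)
  have "expectation (\<lambda>\<omega>. (\<Sum>i\<in>I. c i * X i \<omega>)\<^sup>2) =
    (\<Sum>i\<in>I. \<Sum>j\<in>I. expectation (\<lambda>\<omega>. c i * c j * (X i \<omega> * X j \<omega>)))"
    unfolding expand using int2
    by (subst Bochner_Integration.integral_sum)
      (auto intro!: Bochner_Integration.integrable_sum sum.cong Bochner_Integration.integral_sum)
  also have "\<dots> = (\<Sum>i\<in>I. \<Sum>j\<in>I. if j = i then (c i)\<^sup>2 * expectation (\<lambda>\<omega>. (X i \<omega>)\<^sup>2) else 0)"
    using prod by (intro sum.cong refl) (auto simp: power2_eq_square)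
  also have "\<dots> = (\<Sum>i\<in>I. (c i)\<^sup>2 * expectation (\<lambda>\<omega>. (X i \<omega>)\<^sup>2))"
    using \<open>finite I\<close> by simp
  also have "\<dots> \<le> (\<Sum>i\<in>I. (c i)\<^sup>2)"
    using var by (intro sum_mono) (simp add: mult_left_le)
  finally show "expectation (\<lambda>\<omega>. (\<Sum>i\<in>I. c i * X i \<omega>)\<^sup>2) \<le> (\<Sum>i\<in>I. (c i)\<^sup>2)" .
qed

end

section \<open>Tail of the random quadratic form and the perturbed eigenvalue\<close>

text \<open>Independence is only available for entries on and above the diagonal. Folding the lower
  triangle onto the upper one doubles the off-diagonal weights.\<close>

lemma quadratic_form_upper_triangle:
  assumes "B \<in> carrier_mat n n" "transpose_mat B = B"
  shows "quadratic_form n B x =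
    (\<Sum>p\<in>{(i, j). i \<le> j \<and> j < n}. (if fst p = snd p then 1 else 2) * x (fst p) * x (snd p) * B $$ p)"
proof -
  let ?I = "{(i, j). i \<le> j \<and> j < n}" and ?U = "{(i, j). i < j \<and> j < n}"
    and ?L = "{(i, j). j < i \<and> i < n}"
  let ?f = "\<lambda>p. x (fst p) * x (snd p) * B $$ p"
  have fin: "finite ?I" "finite ?L"
    by (rule finite_subset[of _ "{..<n} \<times> {..<n}"]; auto)+
  have "quadratic_form n B x = sum ?f ({..<n} \<times> {..<n})"
    by (simp add: quadratic_form_def sum.cartesian_product case_prod_unfold mult_ac)
  also have "{..<n} \<times> {..<n} = ?I \<union> ?L" by auto
  also have "sum ?f \<dots> = sum ?f ?I + sum ?f ?L"
    using fin by (intro sum.union_disjoint) auto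
  also have "sum ?f ?L = sum ?f ?U"
    using symmetric_mat_index[OF assms]
    by (intro sum.reindex_bij_witness[of _ prod.swap prod.swap]) auto
  also have "sum ?f ?U = (\<Sum>p\<in>?I. if fst p = snd p then 0 else ?f p)"
    using fin(1) by (intro sum.mono_neutral_cong_left) auto
  finally show ?thesis
    unfolding sum.distrib[symmetric]
    by (simp add: if_distrib if_distribR mult.assoc cong: if_cong) (rule sum.cong, auto)
qed

lemma sub_gaussian_quadratic_form_tail:
  assumes sg: "sub_gaussian_matrix C1 C2 n M E" and v: "(\<Sum>i<n. (v i)\<^sup>2) = 1" and "a > 0"
  shows "measure M {\<omega> \<in> space M. \<bar>quadratic_form n (E \<omega>) v\<bar> \<ge> a} \<le> 4 / a\<^sup>2"
proof -
  interpret prob_space M using sg by (simp add: sub_gaussian_matrix_def)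
  let ?I = "{(i, j). i \<le> j \<and> j < n}"
  let ?X = "\<lambda>p \<omega>. E \<omega> $$ p"
  let ?c = "\<lambda>p. (if fst p = snd p then 1 else 2) * v (fst p) * v (snd p)"
  have fin: "finite ?I" by (rule finite_subset[of _ "{..<n} \<times> {..<n}"]) auto
  have indep: "indep_vars (\<lambda>_. borel) ?X ?I"
    using sg by (simp add: sub_gaussian_matrix_def case_prod_unfold)
  have rv: "random_variable borel (?X p)" if "p \<in> ?I" for p
    using indep that unfolding indep_vars_def by blast
  have psi: "psi2_norm M (?X p) < \<infinity>" if "p \<in> ?I" for p
  proof -
    have "psi2_norm M (?X p) \<le> ennreal C2"
      using sg that unfolding sub_gaussian_matrix_def by auto
    then show ?thesis by (rule le_less_trans) simp
  qed
  have sq: "integrable M (\<lambda>\<omega>. (?X p \<omega>)\<^sup>2)" if "p \<in> ?I" for p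
    using that by (intro psi2_norm_square_integrable rv psi)
  have mom: "expectation (?X p) = 0" "expectation (\<lambda>\<omega>. (?X p \<omega>)\<^sup>2) \<le> 1" if "p \<in> ?I" for p
    using sg that unfolding sub_gaussian_matrix_def by auto
  let ?Y = "\<lambda>\<omega>. \<Sum>p\<in>?I. ?c p * ?X p \<omega>"
  have eq: "quadratic_form n (E \<omega>) v = ?Y \<omega>" if "\<omega> \<in> space M" for \<omega>
    using sg that by (intro quadratic_form_upper_triangle) (auto simp: sub_gaussian_matrix_def)
  \<comment> \<open>Weights are at most 2 times a product of coordinates. Bounding by 4 and
    extending the sum to all pairs lets it factor into two copies of the squared length, which is
    1.\<close>
  have "(\<Sum>p\<in>?I. (?c p)\<^sup>2) \<le> (\<Sum>p\<in>{..<n} \<times> {..<n}. 4 * ((v (fst p))\<^sup>2 * (v (snd p))\<^sup>2))"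
    by (rule order_trans[OF sum_mono sum_mono2]) (auto simp: power_mult_distrib)
  also have "\<dots> = 4 * ((\<Sum>i<n. (v i)\<^sup>2) * (\<Sum>i<n. (v i)\<^sup>2))"
    unfolding sum_product sum.cartesian_product by (simp add: case_prod_unfold sum_distrib_left)
  finally have "(\<Sum>p\<in>?I. (?c p)\<^sup>2) \<le> 4" using v by simp
  then have "expectation (\<lambda>\<omega>. (?Y \<omega>)\<^sup>2) \<le> 4"
    using second_moment_weighted_sum[OF fin indep sq mom, of ?c] by linarith
  moreover have "prob {\<omega> \<in> space M. \<bar>?Y \<omega>\<bar> \<ge> a} \<le> expectation (\<lambda>\<omega>. (?Y \<omega>)\<^sup>2) / a\<^sup>2"
    using \<open>a > 0\<close> rv
    by (intro second_moment_method integrable_square_weighted_sum[OF fin indep sq mom]) auto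
  moreover have "{\<omega> \<in> space M. \<bar>quadratic_form n (E \<omega>) v\<bar> \<ge> a} = {\<omega> \<in> space M. \<bar>?Y \<omega>\<bar> \<ge> a}"
    using eq by auto
  ultimately show ?thesis
    by (metis (no_types, lifting) divide_right_mono order_trans zero_le_power2)
qed

lemma sub_gaussian_eigval_1_lower:
  assumes A: "A \<in> carrier_mat n n" "transpose_mat A = A" and "n \<ge> 1"
    and sg: "sub_gaussian_matrix C1 C2 n M E" and "a > 0"
  shows "measure M {\<omega> \<in> space M. eigval (A + E \<omega>) 1 - eigval A 1 \<ge> - a} \<ge> 1 - 4 / a\<^sup>2"
proof -
  interpret prob_space M using sg by (simp add: sub_gaussian_matrix_def)
  have E: "E \<omega> \<in> carrier_mat n n" "transpose_mat (E \<omega>) = E \<omega>" if "\<omega> \<in> space M" for \<omega>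
    using sg that by (auto simp: sub_gaussian_matrix_def)
  have AE: "A + E \<omega> \<in> carrier_mat n n" "transpose_mat (A + E \<omega>) = A + E \<omega>" if "\<omega> \<in> space M" for \<omega>
    using E[OF that] A by (auto simp: transpose_add[of _ n n])
  have upper: "(\<lambda>\<omega>. E \<omega> $$ (i, j)) \<in> borel_measurable M" if "i \<le> j" "j < n" for i j
    using sg that unfolding sub_gaussian_matrix_def indep_vars_def by fastforce
  have meas: "(\<lambda>\<omega>. E \<omega> $$ (i, j)) \<in> borel_measurable M" if ij: "i < n" "j < n" for i j
  proof (cases "i \<le> j")
    \<comment> \<open>Below the diagonal the entry agrees with its mirror image, but only on
      \<open>space M\<close>.\<close>
    case False
    then have "(\<lambda>\<omega>. E \<omega> $$ (j, i)) \<in> borel_measurable M" using ij by (intro upper) auto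
    also have "?this \<longleftrightarrow> ?thesis"
      using symmetric_mat_index[OF E ij] by (intro measurable_cong) auto
    finally show ?thesis .
  qed (use ij upper in auto)
  have "(\<lambda>\<omega>. (A + E \<omega>) $$ (i, j)) \<in> borel_measurable M" if ij: "i < n" "j < n" for i j
  proof -
    have "(\<lambda>\<omega>. A $$ (i, j) + E \<omega> $$ (i, j)) \<in> borel_measurable M" using meas[OF ij] by simp
    also have "?this \<longleftrightarrow> ?thesis"
      using E A ij by (intro measurable_cong) (auto dest!: E(1))
    finally show ?thesis .
  qed
  from measurable_eigval_1[OF AE \<open>n \<ge> 1\<close> this]
  have ev: "(\<lambda>\<omega>. eigval (A + E \<omega>) 1) \<in> borel_measurable M" .
  \<comment> \<open>This \<open>v\<close> depends on \<open>A\<close> alone, so it is deterministic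
    and the tail bound for fixed vectors applies.\<close>
  obtain v where v: "(\<Sum>i<n. (v i)\<^sup>2) = 1" "quadratic_form n A v = eigval A 1"
    using rayleigh_eigval_1[OF A \<open>n \<ge> 1\<close>] by metis
  have lower: "eigval A 1 + quadratic_form n (E \<omega>) v \<le> eigval (A + E \<omega>) 1"
    if "\<omega> \<in> space M" for \<omega>
  proof -
    have "quadratic_form n (A + E \<omega>) v \<le> eigval (A + E \<omega>) 1 * (\<Sum>i<n. (v i)\<^sup>2)"
      using rayleigh_eigval_1[OF AE[OF that] \<open>n \<ge> 1\<close>] by metis
    moreover have "quadratic_form n (A + E \<omega>) v = quadratic_form n A v + quadratic_form n (E \<omega>) v"
      using A E[OF that] by (simp add: quadratic_form_def algebra_simps flip: sum.distrib)
    ultimately show ?thesis using v by simp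
  qed
  have qf: "(\<lambda>\<omega>. quadratic_form n (E \<omega>) v) \<in> borel_measurable M"
    unfolding quadratic_form_def
    by (intro borel_measurable_sum borel_measurable_times borel_measurable_const meas) auto
  let ?bad = "{\<omega> \<in> space M. \<bar>quadratic_form n (E \<omega>) v\<bar> \<ge> a}"
  have bad: "?bad \<in> events" using qf by measurable
  have "1 - 4 / a\<^sup>2 \<le> prob (space M - ?bad)"
    using sub_gaussian_quadratic_form_tail[OF sg v(1) \<open>a > 0\<close>] prob_compl[OF bad] by simp
  also have "\<dots> \<le> prob {\<omega> \<in> space M. eigval (A + E \<omega>) 1 - eigval A 1 \<ge> - a}"
  proof (rule finite_measure_mono)
    show "{\<omega> \<in> space M. eigval (A + E \<omega>) 1 - eigval A 1 \<ge> - a} \<in> events"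
      using ev by measurable
    show "space M - ?bad \<subseteq> {\<omega> \<in> space M. eigval (A + E \<omega>) 1 - eigval A 1 \<ge> - a}"
      using lower by force
  qed
  finally show ?thesis .
qed

section \<open>Growth of the threshold and the limit\<close>

text \<open>Removes the dependence on \<open>K\<close>, the singular value and the eigenvalue count,
  leaving a bound in \<open>n\<close> alone.\<close>

lemma gap_threshold_ge:
  assumes A: "A \<in> carrier_mat n n" "transpose_mat A = A" and n: "n \<ge> 2" and "K > 0"
    and gap: "top_gap A \<ge> gap_threshold n A K"
  shows "gap_threshold n A K \<ge> 270 * (sqrt (ln (real n)) * real n powr (1 / 4))"
proof -
  let ?s = "ln (3 + largest_singular_value A)"
  \<comment> \<open>The 3 inside the logarithm exceeds \<open>exp 1\<close>, so the logarithmic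
    factor is at least 1.\<close>
  have "exp 1 \<le> (3 :: real)" using exp_le by simp
  also have "3 \<le> 3 + largest_singular_value A"
    using largest_singular_value_nonneg[OF A(1)] n by simp
  finally have s: "?s \<ge> 1" by (subst ln_ge_iff) (auto intro: less_le_trans[OF exp_gt_zero])
  let ?r = "num_top_eigvals n A K"
  let ?m = "max (sqrt (real n) / K) (sqrt (real ?r * ln (real n)) * real n powr (1 / 4))"
  \<comment> \<open>Nothing is known about \<open>?r\<close> yet, and at \<open>?r = 0\<close> the
    second term of the maximum vanishes. The first term makes the threshold, hence the gap,
    positive; this in turn puts the top eigenvalue above the cutoff and gives
    \<open>?r \<ge> 1\<close>.\<close>
  have "0 < sqrt (real n) / K" using n \<open>K > 0\<close> by simp
  then have m: "?m > 0" by simp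
  have th: "gap_threshold n A K = 270 * ?s * ?m" by (simp add: gap_threshold_def)
  then have "top_gap A > 0" using s m gap by (smt (verit) mult_pos_pos)
  moreover have "K * sqrt (real n) > 0" using n \<open>K > 0\<close> by simp
  moreover have "eigval A 1 \<in># eigvals_mset A"
    using rayleigh_eigval_1[OF A] n by (metis le_trans one_le_numeral)
  ultimately have "eigval A 1 \<in># {# x \<in># eigvals_mset A.
      x > eigval A 1 - top_gap A / 2 - 3 * K * sqrt (real n) #}"
    by simp
  then have "?r \<noteq> 0" by (auto simp: num_top_eigvals_def)
  then have "1 \<le> real ?r" by linarith
  then have "1 * ln (real n) \<le> real ?r * ln (real n)"
    using n by (intro mult_right_mono) auto
  then have "sqrt (ln (real n)) * real n powr (1 / 4) \<le> sqrt (real ?r * ln (real n)) * real n powr (1 / 4)"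
    by (intro mult_right_mono) auto
  also have "\<dots> \<le> ?m" by simp
  also have "\<dots> \<le> ?s * ?m" using mult_right_mono[OF s, of ?m] m by linarith
  finally show ?thesis using th by simp
qed

theorem theorem2p2:
  fixes C1 C2 :: real
    and A :: "nat \<Rightarrow> real mat"
    and M :: "nat \<Rightarrow> 'a measure"
    and E :: "nat \<Rightarrow> 'a \<Rightarrow> real mat"
    and K :: "nat \<Rightarrow> real"
  assumes "C1 > 0" and "C2 > 0"
    and "\<And>n. n \<ge> 2 \<Longrightarrow> A n \<in> carrier_mat n n"
    and "\<And>n. n \<ge> 2 \<Longrightarrow> transpose_mat (A n) = A n"
    and "\<And>n. n \<ge> 2 \<Longrightarrow> sub_gaussian_matrix C1 C2 n (M n) (E n)"
    and "\<And>n. n \<ge> 2 \<Longrightarrow> K n > 0"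
    and "\<And>n. n \<ge> 2 \<Longrightarrow> top_gap (A n) \<ge> gap_threshold n (A n) (K n)"
  shows "(\<lambda>n. measure (M n) {\<omega> \<in> space (M n).
            eigval (A n + E n \<omega>) 1 - eigval (A n) 1 \<ge> - gap_threshold n (A n) (K n) / 2})
         \<longlonglongrightarrow> 1"
proof (rule tendsto_sandwich)
  define f where "f n = 270 * (sqrt (ln (real n)) * real n powr (1 / 4))" for n
  let ?G = "\<lambda>n. gap_threshold n (A n) (K n)"
  let ?P = "\<lambda>n. measure (M n) {\<omega> \<in> space (M n).
            eigval (A n + E n \<omega>) 1 - eigval (A n) 1 \<ge> - ?G n / 2}"
  \<comment> \<open>The tail bound at half the threshold gives \<open>4 / (?G n / 2)^2\<close>,
    hence the 16.\<close>
  have lower: "1 - 16 / (f n)\<^sup>2 \<le> ?P n" if n: "n \<ge> 2" for n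
  proof -
    have f: "0 < f n" using n by (simp add: f_def)
    have fG: "f n \<le> ?G n"
      unfolding f_def using assms n by (intro gap_threshold_ge) auto
    then have "16 / (?G n)\<^sup>2 \<le> 16 / (f n)\<^sup>2"
      using f by (intro divide_left_mono power_mono mult_pos_pos zero_less_power) auto
    moreover have "1 - 4 / (?G n / 2)\<^sup>2 \<le> ?P n"
      using sub_gaussian_eigval_1_lower[of "A n" n C1 C2 "M n" "E n" "?G n / 2"] assms n f fG
      by simp
    ultimately show ?thesis by (simp add: power_divide)
  qed
  \<comment> \<open>The hypotheses speak only of \<open>n \<ge> 2\<close>, so both bounds hold
    eventually.\<close>
  show "\<forall>\<^sub>F n in sequentially. 1 - 16 / (f n)\<^sup>2 \<le> ?P n"
    using lower eventually_ge_at_top[of 2] by (rule eventually_mono[rotated])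
  show "\<forall>\<^sub>F n in sequentially. ?P n \<le> 1"
    using eventually_ge_at_top[of 2]
  proof eventually_elim
    case (elim n)
    then interpret prob_space "M n" using assms(5) by (simp add: sub_gaussian_matrix_def)
    show ?case by simp
  qed
  show "(\<lambda>n. 1 - 16 / (f n)\<^sup>2) \<longlonglongrightarrow> 1"
    unfolding f_def by real_asymp
qed simp

end
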